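(* Let $T\colon \mathscr{P}(\mathbb{C})\to \mathscr{P}(\mathbb{C})$ be a mapping (not assumed to be linear or additive). Then $T$ satisfies the Leibniz rule $$T(p\cdot q)=T(p)\cdot q+p\cdot T(q)\qquad\text{for all } p,q\in \mathscr{P}(\mathbb{C})$$ and does not increase the degree if and only if there exist four functions $\psi_0,\psi_1,\tilde\varphi_0,\tilde\varphi_1\colon\mathbb{C}\to\mathbb{C}$ such that $\tilde\varphi_k(ab)=a\tilde\varphi_k(b)+b\tilde\varphi_k(a)$ for all $a,b\in\mathbb{C}$ and $k\in\{0,1\}$, and such that, for every $p\in\mathscr{P}(\mathbb{C})$ written as $p(z)=a\prod_{j=1}^{N}(z-z_j)$ with $N\in\mathbb{N}_0$ and $a,z_1,\dots,z_N\in\mathbb{C}$, one has for all $z\in\mathbb{C}$ $$T(p)(z)=a\sum_{j=1}^{N}\Big(\prod_{i\neq j}(z-z_i)\Big)\Big(\sum_{k=0}^{1}\psi_k(-z_j)z^k+\sum_{k=0}^{1}\tilde\varphi_k(-z_j)z^k\Big)+\tilde\varphi_0(a)\prod_{j=1}^{N}(z-z_j).$$ Consequently, for such $T$, for each monomial $p(z)=z^N$ there exist constants $c_p,d_p\in\mathbb{C}$ such that $T(p)=c_p\cdot p'+d_p\cdot p$.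
   Context: $\mathscr{P}(\mathbb{C})$ denotes the set of all polynomials $p\colon\mathbb{C}\to\mathbb{C}$ with complex coefficients (including the zero polynomial), with pointwise multiplication and addition. $\mathbb{N}_0=\{0,1,2,\dots\}$. An operator $T\colon\mathscr{P}(\mathbb{C})\to\mathscr{P}(\mathbb{C})$ does not increase the degree if for any polynomial $p$ of degree $N$ the degree of $T(p)$ is not greater than $N$ (the zero polynomial has degree $-\infty$). In $\prod_{i\neq j}$ the index $i$ ranges over $\{1,\dots,N\}\setminus\{j\}$; empty products equal $1$ and empty sums equal $0$ (so constants $p=a$ correspond to $N=0$). $p'$ is the derivative of $p$. *)

theory Defs
  imports Complex_Main "HOL-Library.Extended_Real" "HOL-Computational_Algebra.Polynomial"
begin

text \<open>
  Since \<open>\<complex>\<close> is infinite, complex polynomial functions are identified with elements of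
  \<^typ>\<open>complex poly\<close>; a map on polynomials is an arbitrary function on this type.
\<close>

definition leibniz_rule :: "(complex poly \<Rightarrow> complex poly) \<Rightarrow> bool" where
  "leibniz_rule T \<longleftrightarrow> (\<forall>p q. T (p * q) = T p * q + p * T q)"

text \<open>The library has \<open>degree 0 = 0\<close>; here the zero polynomial has degree \<open>-\<infinity>\<close>.\<close>

definition ext_degree :: "complex poly \<Rightarrow> ereal" where
  "ext_degree p = (if p = 0 then -\<infinity> else ereal (real (degree p)))"

definition degree_nonincreasing :: "(complex poly \<Rightarrow> complex poly) \<Rightarrow> bool" where
  "degree_nonincreasing T \<longleftrightarrow> (\<forall>p. ext_degree (T p) \<le> ext_degree p)"

end

theory Submission
  imports Defs "HOL-Computational_Algebra.Fundamental_Theorem_Algebra"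
begin

text \<open>
  A map obeying the Leibniz rule is determined by its values on a set of multiplicative
  generators, and by the fundamental theorem of algebra the constants together with the monic
  linear polynomials generate all complex polynomials multiplicatively. If the degree does not
  increase, constants go to constants, \<open>T [:a:] = [:\<phi> a:]\<close>, and monic
  linear polynomials go to polynomials \<open>L w = T [:-w, 1:]\<close> of degree at most \<open>1\<close>; the Leibniz
  rule for finite products (\<open>leibniz_rule_prod\<close>) then yields the formula. The
  function \<open>\<phi>\<close> inherits the Leibniz rule, while \<open>L\<close> is arbitrary: monic linear polynomials
  satisfy no multiplicative relations among themselves, by unique factorization. Hence one
  may take \<open>\<phi>0 = \<phi>\<close> and \<open>\<phi>1 = 0\<close> and let \<open>\<psi>0\<close> and \<open>\<psi>1\<close> absorb the two coefficients of \<open>L\<close>.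

  Conversely, suppose that \<open>T\<close> is given by the formula. Then \<open>T\<close> satisfies the Leibniz rule
  when one of the factors is a constant or a monic linear polynomial
  (\<open>root_formula_leibniz_const\<close>, \<open>root_formula_linear_factor\<close>), because the sum in the formula
  behaves like a derivative when a factor is added (\<open>derivation_sum_insert\<close>). If the rule
  \<open>T (p * q) = T p * q + p * T q\<close> holds for some \<open>p\<close> and every \<open>q\<close>, it also holds with \<open>p\<close>
  multiplied by a linear factor, so it holds for every \<open>p\<close>. The degree bound
  spreads in the same way, one linear factor at a time.
\<close>

section \<open>Complex polynomials as products of linear factors\<close>

definition poly_of_roots :: "complex \<Rightarrow> nat \<Rightarrow> (nat \<Rightarrow> complex) \<Rightarrow> complex poly" where
  "poly_of_roots a N w = smult a (\<Prod>j\<in>{1..N}. [:- w j, 1:])"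

lemma poly_poly_of_roots:
  "poly (poly_of_roots a N w) z = a * (\<Prod>j\<in>{1..N}. z - w j)"
  by (simp add: poly_of_roots_def poly_prod)

lemma eq_poly_of_roots_iff:
  "p = poly_of_roots a N w \<longleftrightarrow> (\<forall>z. poly p z = a * (\<Prod>j\<in>{1..N}. z - w j))"
  by (simp add: poly_eq_poly_eq_iff[symmetric] fun_eq_iff poly_poly_of_roots)

lemma complex_poly_linear_factor_induct [case_names const linear_factor]:
  fixes p :: "complex poly"
  assumes const: "\<And>a. P [:a:]"
    and linear_factor: "\<And>w p. P p \<Longrightarrow> P ([:- w, 1:] * p)"
  shows "P p"
proof (induction "degree p" arbitrary: p)
  case 0
  then show ?case using const by (metis degree_eq_zeroE)
next
  case (Suc n)
  then have "\<not> constant (poly p)" by (simp add: constant_degree)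
  then obtain w where "poly p w = 0" using fundamental_theorem_of_algebra by blast
  then obtain q where q: "p = [:- w, 1:] * q" by (meson dvdE poly_eq_0_iff_dvd)
  with Suc.hyps(2) have "q \<noteq> 0" by auto
  with q have "degree p = Suc (degree q)"
    by (simp add: degree_mult_eq del: mult_pCons_left)
  with Suc have "P q" by simp
  then show ?case unfolding q by (rule linear_factor)
qed

lemma poly_of_roots_Suc:
  "poly_of_roots a (Suc N) w = [:- w (Suc N), 1:] * poly_of_roots a N w"
  unfolding poly_of_roots_def prod.nat_ivl_Suc'[of 1 N, simplified] by simp

lemma complex_poly_split:
  fixes p :: "complex poly"
  obtains a N w where "p = poly_of_roots a N w"
proof -
  have "\<exists>a N w. p = poly_of_roots a N w"
  proof (induction p rule: complex_poly_linear_factor_induct)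
    case (const a)
    have "[:a:] = poly_of_roots a 0 w" for w by (simp add: poly_of_roots_def)
    then show ?case by blast
  next
    case (linear_factor v p)
    then obtain a N w where p: "p = poly_of_roots a N w" by blast
    have "poly_of_roots a N (w(Suc N := v)) = p"
      unfolding p poly_of_roots_def by (intro arg_cong[where f = "smult a"] prod.cong) auto
    then have "[:- v, 1:] * p = poly_of_roots a (Suc N) (w(Suc N := v))"
      by (simp add: poly_of_roots_Suc)
    then show ?case by blast
  qed
  then show ?thesis using that by blast
qed

section \<open>The Leibniz rule for finite products\<close>

text \<open>
  If \<open>g\<close> is the derivative of \<open>f\<close>, this sum is the derivative of the product of the \<open>f i\<close>; the
  recursion is thus the product rule. It turns a Leibniz map into the sum and, read in the other
  direction, shows that the sum defines a Leibniz map.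
\<close>

lemma derivation_sum_insert:
  fixes f g :: "'i \<Rightarrow> 'a :: comm_semiring_1"
  assumes "finite I" "k \<notin> I"
  shows "(\<Sum>j\<in>insert k I. (\<Prod>i\<in>insert k I - {j}. f i) * g j) =
    g k * (\<Prod>i\<in>I. f i) + f k * (\<Sum>j\<in>I. (\<Prod>i\<in>I - {j}. f i) * g j)"
proof -
  have "(\<Prod>i\<in>insert k I - {j}. f i) * g j = f k * ((\<Prod>i\<in>I - {j}. f i) * g j)" if "j \<in> I" for j
  proof -
    have "insert k I - {j} = insert k (I - {j})" using that assms(2) by auto
    then show ?thesis using assms by (simp add: mult.assoc)
  qed
  then show ?thesis using assms by (simp add: sum_distrib_left mult.commute)
qed

lemma leibniz_ruleD: "leibniz_rule T \<Longrightarrow> T (p * q) = T p * q + p * T q"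
  by (simp add: leibniz_rule_def)

lemma leibniz_rule_1: "leibniz_rule T \<Longrightarrow> T 1 = 0"
  using leibniz_ruleD[of T 1 1] by simp

lemma leibniz_rule_prod:
  assumes "leibniz_rule T" "finite I"
  shows "T (\<Prod>i\<in>I. f i) = (\<Sum>j\<in>I. (\<Prod>i\<in>I - {j}. f i) * T (f j))"
  using assms(2)
proof (induction I)
  case empty
  then show ?case by (simp add: leibniz_rule_1[OF assms(1)])
next
  case (insert k I)
  then show ?case
    unfolding derivation_sum_insert[OF insert.hyps] by (simp add: leibniz_ruleD[OF assms(1)])
qed

lemma leibniz_rule_power:
  assumes "leibniz_rule T"
  shows "T (p ^ Suc n) = of_nat (Suc n) * p ^ n * T p"
  using leibniz_rule_prod[OF assms, of "{..n}" "\<lambda>_. p"] by (simp add: mult.assoc)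

section \<open>Degree bounds\<close>

text \<open>
  The condition \<open>T 0 = 0\<close> is what remains of the convention that \<open>0\<close> has degree \<open>-\<infinity>\<close>.
\<close>

lemma degree_nonincreasing_iff:
  "degree_nonincreasing T \<longleftrightarrow> T 0 = 0 \<and> (\<forall>p. degree (T p) \<le> degree p)"
proof -
  have "ext_degree q \<le> ext_degree p \<longleftrightarrow> q = 0 \<or> p \<noteq> 0 \<and> degree q \<le> degree p" for p q
    by (simp add: ext_degree_def)
  then show ?thesis unfolding degree_nonincreasing_def by (metis degree_0 le0)
qed

lemma degree_le_1_eq: "degree p \<le> 1 \<Longrightarrow> p = [:coeff p 0, coeff p 1:]"
  by (intro poly_eqI) (auto simp: coeff_pCons coeff_eq_0 split: nat.split)

section \<open>Leibniz maps in terms of leading coefficient and roots\<close>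

definition root_formula ::
    "(complex \<Rightarrow> complex) \<Rightarrow> (complex \<Rightarrow> complex poly) \<Rightarrow> complex \<Rightarrow> nat \<Rightarrow> (nat \<Rightarrow> complex) \<Rightarrow> complex poly"
  where "root_formula \<phi> L a N w =
    smult a (\<Sum>j\<in>{1..N}. (\<Prod>i\<in>{1..N} - {j}. [:- w i, 1:]) * L (w j)) +
    smult (\<phi> a) (\<Prod>j\<in>{1..N}. [:- w j, 1:])"

lemma poly_root_formula:
  "poly (root_formula \<phi> L a N w) z =
    a * (\<Sum>j\<in>{1..N}. (\<Prod>i\<in>{1..N} - {j}. z - w i) * poly (L (w j)) z) +
    \<phi> a * (\<Prod>j\<in>{1..N}. z - w j)"
  by (simp add: root_formula_def poly_sum poly_prod)

lemma root_formula_Suc: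
  "root_formula \<phi> L a (Suc N) w =
    L (w (Suc N)) * poly_of_roots a N w + [:- w (Suc N), 1:] * root_formula \<phi> L a N w"
proof -
  have "{1..Suc N} = insert (Suc N) {1..N}" by auto
  moreover have "finite {1..N}" "Suc N \<notin> {1..N}" by auto
  ultimately show ?thesis
    unfolding root_formula_def poly_of_roots_def
    by (simp only: derivation_sum_insert prod.insert not_False_eq_True)
       (simp only: smult_add_right mult_smult_right distrib_left add.assoc)
qed

lemma root_formula_smult:
  assumes "\<phi> (c * a) = c * \<phi> a + \<phi> c * a"
  shows "root_formula \<phi> L (c * a) N w =
    smult (\<phi> c) (poly_of_roots a N w) + smult c (root_formula \<phi> L a N w)"
  by (simp add: root_formula_def poly_of_roots_def assms smult_add_right smult_add_left)

lemma leibniz_rule_root_formula: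
  assumes "leibniz_rule T" "\<And>a. T [:a:] = [:\<phi> a:]"
  shows "T (poly_of_roots a N w) = root_formula \<phi> (\<lambda>v. T [:- v, 1:]) a N w"
proof -
  let ?q = "\<Prod>j\<in>{1..N}. [:- w j, 1:]"
  have "T (poly_of_roots a N w) = T ([:a:] * ?q)" by (simp add: poly_of_roots_def)
  also have "\<dots> = T [:a:] * ?q + [:a:] * T ?q" by (rule leibniz_ruleD[OF assms(1)])
  also have "\<dots> = root_formula \<phi> (\<lambda>v. T [:- v, 1:]) a N w"
    by (simp add: assms(2) leibniz_rule_prod[OF assms(1)] root_formula_def)
  finally show ?thesis .
qed

context
  fixes T :: "complex poly \<Rightarrow> complex poly" and \<phi> :: "complex \<Rightarrow> complex"
    and L :: "complex \<Rightarrow> complex poly"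
  assumes \<phi>: "\<And>a b. \<phi> (a * b) = a * \<phi> b + b * \<phi> a"
    and T: "\<And>a N w. T (poly_of_roots a N w) = root_formula \<phi> L a N w"
begin

lemma root_formula_const: "T [:a:] = [:\<phi> a:]"
  using T[of a 0] by (simp add: poly_of_roots_def root_formula_def)

lemma root_formula_leibniz_const: "T ([:c:] * q) = T [:c:] * q + [:c:] * T q"
proof -
  obtain a N w where q: "q = poly_of_roots a N w" by (rule complex_poly_split)
  have "[:c:] * q = poly_of_roots (c * a) N w" by (simp add: q poly_of_roots_def mult.commute)
  moreover have "\<phi> (c * a) = c * \<phi> a + \<phi> c * a" by (simp add: \<phi> ac_simps)
  ultimately show ?thesis by (simp add: T root_formula_smult root_formula_const q)
qed

text \<open>
  Here \<open>L v\<close> plays the part of \<open>T [:- v, 1:]\<close>. The formula refers to a numbered list of roots, so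
  multiplication by a linear factor is the addition of a last root \<open>v\<close> to any list for \<open>q\<close>.
\<close>

lemma root_formula_linear_factor: "T ([:- v, 1:] * q) = L v * q + [:- v, 1:] * T q"
proof -
  obtain a N w where q: "q = poly_of_roots a N w" by (rule complex_poly_split)
  let ?w = "w(Suc N := v)"
  have q': "q = poly_of_roots a N ?w"
    unfolding q poly_of_roots_def by (intro arg_cong[where f = "smult a"] prod.cong) auto
  have "T ([:- v, 1:] * q) = T (poly_of_roots a (Suc N) ?w)"
    by (simp add: q' poly_of_roots_Suc)
  also have "\<dots> = L v * q + [:- v, 1:] * T q"
    unfolding T root_formula_Suc by (simp add: q' T)
  finally show ?thesis .
qed

lemma root_formula_leibniz: "leibniz_rule T"
proof -
  have "T (p * q) = T p * q + p * T q" for p q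
  proof (induction p arbitrary: q rule: complex_poly_linear_factor_induct)
    case (const a)
    show ?case by (rule root_formula_leibniz_const)
  next
    case (linear_factor v p)
    have "T ([:- v, 1:] * p * q) = T ([:- v, 1:] * (p * q))" by (simp only: mult.assoc)
    also have "\<dots> = L v * (p * q) + [:- v, 1:] * (T p * q + p * T q)"
      by (simp only: root_formula_linear_factor linear_factor)
    also have "\<dots> = T ([:- v, 1:] * p) * q + [:- v, 1:] * p * T q"
      unfolding root_formula_linear_factor by (simp only: algebra_simps)
    finally show ?case .
  qed
  then show ?thesis by (simp add: leibniz_rule_def)
qed

lemma root_formula_degree:
  assumes L: "\<And>v. degree (L v) \<le> 1"
  shows "degree_nonincreasing T"
proof -
  have T0: "T 0 = 0"
    using root_formula_const[of 0] \<phi>[of 0 0] by simp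
  have "degree (T p) \<le> degree p" for p
  proof (induction p rule: complex_poly_linear_factor_induct)
    case (const a)
    show ?case by (simp add: root_formula_const)
  next
    case (linear_factor v p)
    show ?case
    proof (cases "p = 0")
      case True
      then show ?thesis by (simp add: T0)
    next
      case False
      then have deg: "degree ([:- v, 1:] * p) = Suc (degree p)" by (subst degree_mult_eq) auto
      have "degree (L v * p) \<le> Suc (degree p)"
        using degree_mult_le[of "L v" p] L[of v] by linarith
      moreover have "degree ([:- v, 1:] * T p) \<le> Suc (degree p)"
        using degree_mult_le[of "[:- v, 1:]" "T p"] linear_factor by simp
      ultimately show ?thesis
        unfolding deg root_formula_linear_factor by (rule degree_add_le)
    qed
  qed
  with T0 show ?thesis by (simp add: degree_nonincreasing_iff)
qed

end

lemma root_formula_characterization: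
  "leibniz_rule T \<and> degree_nonincreasing T \<longleftrightarrow>
    (\<exists>\<phi> L. (\<forall>a b. \<phi> (a * b) = a * \<phi> b + b * \<phi> a) \<and> (\<forall>v. degree (L v) \<le> 1) \<and>
      (\<forall>a N w. T (poly_of_roots a N w) = root_formula \<phi> L a N w))"
    (is "?l \<longleftrightarrow> ?r")
proof
  assume ?l
  then have leibniz: "leibniz_rule T" and deg: "\<And>p. degree (T p) \<le> degree p"
    by (auto simp: degree_nonincreasing_iff)
  define \<phi> where "\<phi> a = coeff (T [:a:]) 0" for a
  have T_const: "T [:a:] = [:\<phi> a:]" for a
    using deg[of "[:a:]"] by (auto simp: \<phi>_def elim: degree_eq_zeroE)
  have "\<phi> (a * b) = a * \<phi> b + b * \<phi> a" for a b
    using leibniz_ruleD[OF leibniz, of "[:b:]" "[:a:]"] by (simp add: T_const mult.commute)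
  moreover have "degree (T [:- v, 1:]) \<le> 1" for v
    using deg[of "[:- v, 1:]"] by simp
  ultimately show ?r
    using leibniz_rule_root_formula[OF leibniz, of \<phi>, OF T_const]
    by (intro exI[of _ \<phi>] exI[of _ "\<lambda>v. T [:- v, 1:]"]) blast
next
  assume ?r
  then show ?l using root_formula_leibniz root_formula_degree by metis
qed

text \<open>
  In the rule \<open>T (X ^ Suc n) = Suc n * X ^ n * T X\<close> the factor \<open>Suc n * X ^ n\<close> is the derivative of
  \<open>X ^ Suc n\<close>. The constant coefficient of \<open>T X\<close> therefore contributes a multiple of \<open>p'\<close>, and its
  linear term, which raises \<open>X ^ n\<close> back to \<open>X ^ Suc n\<close>, a multiple of \<open>p\<close>.
\<close>

lemma leibniz_rule_monom:
  assumes "leibniz_rule T" "degree_nonincreasing T"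
  shows "\<exists>c d. T (monom 1 N) = smult c (pderiv (monom 1 N)) + smult d (monom 1 N)"
proof (cases N)
  case 0
  then have "T (monom 1 N) = smult 0 (pderiv (monom 1 N)) + smult 0 (monom 1 N)"
    by (simp add: leibniz_rule_1[OF assms(1)])
  then show ?thesis by blast
next
  case (Suc n)
  let ?X = "monom 1 1 :: complex poly"
  have "degree (T ?X) \<le> 1"
    using assms(2) by (metis degree_nonincreasing_iff degree_monom_eq one_neq_zero)
  then obtain c d where "T ?X = [:c, d:]" using degree_le_1_eq by blast
  then have TX: "T ?X = smult c 1 + smult d ?X"
    by (simp add: monom_altdef)
  have "T (monom 1 N) = T (?X ^ Suc n)" by (simp add: Suc monom_power del: power_Suc)
  also have "\<dots> = smult (of_nat N) (monom 1 n) * (smult c 1 + smult d ?X)"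
    unfolding leibniz_rule_power[OF assms(1)] TX
    by (simp add: Suc monom_power of_nat_poly del: of_nat_Suc)
  also have "\<dots> = smult c (smult (of_nat N) (monom 1 n)) +
      smult (of_nat N * d) (monom 1 n * ?X)"
    by (simp add: distrib_left mult.commute)
  also have "smult (of_nat N) (monom 1 n) = pderiv (monom (1 :: complex) N)"
    by (simp add: Suc pderiv_monom smult_monom)
  also have "monom 1 n * ?X = monom 1 N" by (simp add: Suc mult_monom)
  finally show ?thesis by blast
qed

section \<open>The characterization\<close>

theorem corollary2:
  fixes T :: "complex poly \<Rightarrow> complex poly"
  shows "(leibniz_rule T \<and> degree_nonincreasing T \<longleftrightarrow>
      (\<exists>\<psi>0 \<psi>1 \<phi>0 \<phi>1 :: complex \<Rightarrow> complex.
        (\<forall>a b. \<phi>0 (a * b) = a * \<phi>0 b + b * \<phi>0 a) \<and>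
        (\<forall>a b. \<phi>1 (a * b) = a * \<phi>1 b + b * \<phi>1 a) \<and>
        (\<forall>(p :: complex poly) (N :: nat) (a :: complex) (w :: nat \<Rightarrow> complex).
          (\<forall>z. poly p z = a * (\<Prod>j\<in>{1..N}. z - w j)) \<longrightarrow>
          (\<forall>z. poly (T p) z =
            a * (\<Sum>j\<in>{1..N}. (\<Prod>i\<in>{1..N} - {j}. z - w i) *
                  ((\<psi>0 (- w j) * z ^ 0 + \<psi>1 (- w j) * z ^ 1) +
                   (\<phi>0 (- w j) * z ^ 0 + \<phi>1 (- w j) * z ^ 1)))
            + \<phi>0 a * (\<Prod>j\<in>{1..N}. z - w j))))) \<and>
    (leibniz_rule T \<and> degree_nonincreasing T \<longrightarrow>
      (\<forall>N :: nat. \<exists>c d :: complex.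
        T (monom 1 N) = smult c (pderiv (monom 1 N)) + smult d (monom 1 N)))"
proof (intro conjI impI allI, goal_cases)
  case 1
  show ?case (is "_ \<longleftrightarrow> ?formula")
  proof
    assume "leibniz_rule T \<and> degree_nonincreasing T"
    then obtain \<phi> L where \<phi>: "\<And>a b. \<phi> (a * b) = a * \<phi> b + b * \<phi> a"
      and L: "\<And>v. degree (L v) \<le> 1"
      and T: "\<And>a N w. T (poly_of_roots a N w) = root_formula \<phi> L a N w"
      unfolding root_formula_characterization by blast
    \<comment> \<open>The formula evaluates \<open>\<psi>0\<close> and \<open>\<psi>1\<close> at \<open>-v\<close> for a root \<open>v\<close> and adds \<open>\<phi> (-v)\<close>, which is
      compensated here.\<close>
    define \<psi>0 where "\<psi>0 x = coeff (L (- x)) 0 - \<phi> x" for x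
    define \<psi>1 where "\<psi>1 x = coeff (L (- x)) 1" for x
    have "poly (L v) z =
        (\<psi>0 (- v) * z ^ 0 + \<psi>1 (- v) * z ^ 1) + (\<phi> (- v) * z ^ 0 + 0 * z ^ 1)" for v z
      by (subst degree_le_1_eq[OF L]) (simp add: \<psi>0_def \<psi>1_def)
    with \<phi> T show ?formula
      by - (rule exI[of _ \<psi>0], rule exI[of _ \<psi>1], rule exI[of _ \<phi>], rule exI[of _ "\<lambda>_. 0"],
          unfold eq_poly_of_roots_iff[symmetric], simp add: poly_root_formula)
  next
    assume ?formula
    then obtain \<psi>0 \<psi>1 \<phi>0 \<phi>1 where \<phi>0: "\<forall>a b. \<phi>0 (a * b) = a * \<phi>0 b + b * \<phi>0 a"
      and T: "\<forall>p N a w. p = poly_of_roots a N w \<longrightarrow> (\<forall>z. poly (T p) z =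
            a * (\<Sum>j\<in>{1..N}. (\<Prod>i\<in>{1..N} - {j}. z - w i) *
                  ((\<psi>0 (- w j) * z ^ 0 + \<psi>1 (- w j) * z ^ 1) +
                   (\<phi>0 (- w j) * z ^ 0 + \<phi>1 (- w j) * z ^ 1)))
            + \<phi>0 a * (\<Prod>j\<in>{1..N}. z - w j))"
      unfolding eq_poly_of_roots_iff[symmetric] by (elim exE conjE) (rule that)
    define L where "L v = [:\<psi>0 (- v) + \<phi>0 (- v), \<psi>1 (- v) + \<phi>1 (- v):]" for v
    have "T (poly_of_roots a N w) = root_formula \<phi>0 L a N w" for a N w
      by (rule poly_eq_poly_eq_iff[THEN iffD1], rule ext) (simp add: T[rule_format, OF refl] poly_root_formula L_def algebra_simps)
    moreover have "degree (L v) \<le> 1" for v by (simp add: L_def)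
    ultimately show "leibniz_rule T \<and> degree_nonincreasing T"
      using \<phi>0 unfolding root_formula_characterization by blast
  qed
next
  case (2 N)
  then show ?case by (blast intro: leibniz_rule_monom)
qed

end
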